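(* Consider the error system in $\mathbb R^n$ $$\dot e_p=\mathcal F_e+e_v,\qquad \dot e_v=a_e+a_d-\dot{\mathcal F}_e,\qquad \mathcal F_e=-k_{\mathcal Fe}e_p,\quad k_{\mathcal Fe}>0,$$ with control input $a_e$ and disturbance $a_d$ satisfying the norm-bounded disturbance assumption of the context. Let $$V_{epv}=k_{ep}V_{ep}+\tfrac12e_v\cdot e_v+\frac{\tilde\zeta_1^2}{2\rho_1}+\frac{\tilde\zeta_2^2}{2\rho_2},\qquad V_{ep}=\tfrac12 e_p\cdot e_p,\qquad \tilde\zeta=(\tilde\zeta_1,\tilde\zeta_2)^\top=\zeta-\hat\zeta.$$ By applying the control law $$a_e=-k_{ep}e_p-k_{ev}e_v-\hat\zeta_1\mathbf F(\hat\zeta_1e_v/\epsilon_p)-\hat\zeta_2e_v,\qquad k_{ep},k_{ev},\epsilon_p>0,$$ with the adaptive gains $\hat\zeta=(\hat\zeta_1,\hat\zeta_2)^\top$ updated by the law given in the context, one has $\dot V_{epv}<0$ whenever the system is outside the attractive set $$\Delta_p=\{(e_p,e_v)\;|\;\|e_p\|\le\delta_p,\ \|e_v\|\le\delta_v\},\qquad \delta_p=\sqrt{\frac{n\kappa\epsilon_p}{k_{ep}k_{\mathcal Fe}}},\qquad \delta_v=\sqrt{\frac{n\kappa\epsilon_p}{k_{ev}}},$$ where $\kappa=\max_{x\in\mathbb R}\,(|x|-xF(x))$.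
   Context: **The functions $F$, $\mathbf F$.** $F:\mathbb R\to\mathbb R$ satisfies $F(0)=0$, $\lim_{x\to\infty}F(x)=1$, $\lim_{x\to-\infty}F(x)=-1$, and $\mathbf F:\mathbb R^n\to\mathbb R^n$ is its element-wise version. The maximum defining $\kappa$ is understood to exist. **Norm-bounded disturbance assumption.** With the lumped term $\chi_p=a_d-\dot{\mathcal F}_e$, there exist unknown constants $\zeta=(\zeta_1,\zeta_2)^\top$ such that $\|\chi_p\|\le\zeta_1+\zeta_2\|e_v\|$, and $\zeta\in\Xi=\{\xi\in\mathbb R^2\,|\,\alpha(\xi)\le0\}$, a convex set, where $\alpha:\mathbb R^2\to\mathbb R$ is a smooth convex function. **Adaptive update law (with projection).** With $\alpha=\alpha(\hat\zeta)$ and $\nabla\alpha=\nabla\alpha(\hat\zeta)$, $$\dot{\hat\zeta}=\begin{cases}P\epsilon&\text{if }\alpha<0\text{ or }\nabla\alpha^\top P\epsilon\le0,\\ P\epsilon-P\frac{\nabla\alpha\nabla\alpha^\top}{\nabla\alpha^\top P\nabla\alpha}P\epsilon&\text{otherwise,}\end{cases}\quad P=\begin{bmatrix}\rho_1&0\\0&\rho_2\end{bmatrix}>0,\quad \epsilon=\begin{bmatrix}\|e_v\|\\ \|e_v\|^2\end{bmatrix}.$$ $\dot V_{epv}$ denotes the time derivative of $V_{epv}$ along solutions of the closed-loop system (error system together with the adaptive law). *)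

theory Defs
  imports "HOL-Analysis.Analysis"
begin

definition elementwise :: "(real \<Rightarrow> real) \<Rightarrow> real^'n \<Rightarrow> real^'n" where
  "elementwise F x = (\<chi> i. F (x $ i))"

(* C^k through iterated directional derivatives along the standard basis. *)
fun C_k_function :: "nat \<Rightarrow> ('a::euclidean_space \<Rightarrow> real) \<Rightarrow> bool" where
  "C_k_function 0 f \<longleftrightarrow> continuous_on UNIV f"
| "C_k_function (Suc k) f \<longleftrightarrow>
     f differentiable_on UNIV \<and>
     (\<forall>b\<in>Basis. C_k_function k (\<lambda>x. frechet_derivative f (at x) b))"

definition smooth_function :: "('a::euclidean_space \<Rightarrow> real) \<Rightarrow> bool" where
  "smooth_function f \<longleftrightarrow> (\<forall>k. C_k_function k f)"

(* Meaningful only where f is differentiable; the gradient is then unique. *)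
definition gradient :: "('a::euclidean_space \<Rightarrow> real) \<Rightarrow> 'a \<Rightarrow> 'a" where
  "gradient f x = (THE D. GDERIV f x :> D)"

definition positive_definite :: "real^'m^'m \<Rightarrow> bool" where
  "positive_definite A \<longleftrightarrow> transpose A = A \<and> (\<forall>x. x \<noteq> 0 \<longrightarrow> 0 < x \<bullet> (A *v x))"

definition gain_matrix :: "real \<Rightarrow> real \<Rightarrow> real^2^2" where
  "gain_matrix \<rho>1 \<rho>2 = vector [vector [\<rho>1, 0], vector [0, \<rho>2]]"

definition regressor :: "real^'n \<Rightarrow> real^2" where
  "regressor ev = vector [norm ev, (norm ev)\<^sup>2]"

definition admissible_set :: "(real^2 \<Rightarrow> real) \<Rightarrow> (real^2) set" where
  "admissible_set \<alpha> = {\<xi>. \<alpha> \<xi> \<le> 0}"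

definition control_law ::
  "(real \<Rightarrow> real) \<Rightarrow> real \<Rightarrow> real \<Rightarrow> real \<Rightarrow> real^'n \<Rightarrow> real^'n \<Rightarrow> real^2 \<Rightarrow> real^'n" where
  "control_law F kep kev \<epsilon>p ep ev zh =
     - (kep *\<^sub>R ep) - kev *\<^sub>R ev
     - (zh $ 1) *\<^sub>R elementwise F ((zh $ 1 / \<epsilon>p) *\<^sub>R ev)
     - (zh $ 2) *\<^sub>R ev"

definition adaptive_law ::
  "(real^2 \<Rightarrow> real) \<Rightarrow> real^2^2 \<Rightarrow> real^'n \<Rightarrow> real^2 \<Rightarrow> real^2" where
  "adaptive_law \<alpha> P ev zh =
     (let g = gradient \<alpha> zh; \<epsilon> = regressor ev in
      if \<alpha> zh < 0 \<or> g \<bullet> (P *v \<epsilon>) \<le> 0 then P *v \<epsilon>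
      else P *v \<epsilon> -
        (1 / (g \<bullet> (P *v g))) *\<^sub>R
        ((P ** ((columnvector g :: real^1^2) ** (rowvector g :: real^2^1)) ** P) *v \<epsilon>))"

definition V_ep :: "real^'n \<Rightarrow> real" where
  "V_ep ep = 1/2 * (ep \<bullet> ep)"

definition V_epv ::
  "real \<Rightarrow> real \<Rightarrow> real \<Rightarrow> real^2 \<Rightarrow> real^'n \<Rightarrow> real^'n \<Rightarrow> real^2 \<Rightarrow> real" where
  "V_epv kep \<rho>1 \<rho>2 \<zeta> ep ev zh =
     kep * V_ep ep + 1/2 * (ev \<bullet> ev)
     + ((\<zeta> - zh) $ 1)\<^sup>2 / (2 * \<rho>1) + ((\<zeta> - zh) $ 2)\<^sup>2 / (2 * \<rho>2)"

definition attractive_set ::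
  "real \<Rightarrow> real \<Rightarrow> real \<Rightarrow> real \<Rightarrow> real \<Rightarrow> ((real^'n) \<times> (real^'n)) set" where
  "attractive_set kFe kep kev \<epsilon>p \<kappa> =
     {(ep, ev). norm ep \<le> sqrt (real CARD('n) * \<kappa> * \<epsilon>p / (kep * kFe)) \<and>
                norm ev \<le> sqrt (real CARD('n) * \<kappa> * \<epsilon>p / kev)}"

end

theory Submission
  imports Defs
begin

text \<open>Along the closed loop the cross terms in \<open>e\<^sub>p \<bullet> e\<^sub>v\<close> cancel. If \<open>z\<close> is the estimate of
  \<open>\<zeta>\<close>, the control term \<open>z\<^sub>1 F(z\<^sub>1 e\<^sub>v / \<epsilon>\<^sub>p)\<close> contributes at least \<open>z\<^sub>1 |e\<^sub>v|\<close> to the dissipation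
  up to the error \<open>n \<kappa> \<epsilon>\<^sub>p\<close>, one \<open>\<kappa> \<epsilon>\<^sub>p\<close> for each coordinate. The adaptive law compensates the
  unknown bound on the disturbance; its projection can only decrease the derivative, because the
  gradient of the convex function \<open>\<alpha>\<close> at a point where \<open>\<alpha> \<ge> 0\<close> makes a nonpositive inner
  product with the direction to a point where \<open>\<alpha> \<le> 0\<close>. Hence the derivative of \<open>V\<close> is at most
  \<open>n \<kappa> \<epsilon>\<^sub>p - k\<^sub>e\<^sub>p k\<^sub>F\<^sub>e |e\<^sub>p|\<^sup>2 - k\<^sub>e\<^sub>v |e\<^sub>v|\<^sup>2\<close>, which is negative outside the attractive set.\<close>

text \<open>Restricting \<open>f\<close> to the line through \<open>x\<close> and \<open>y\<close>
  reduces the claim to the one-variable tangent inequality, with tangent point 0 and evaluation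
  point 1.\<close>

lemma convex_on_above_tangent_plane:
  fixes f :: "'a::real_normed_vector \<Rightarrow> real"
  assumes "convex_on UNIV f" and "(f has_derivative f') (at x)"
  shows "f' (y - x) \<le> f y - f x"
proof -
  define g where "g = (\<lambda>s::real. f (x + s *\<^sub>R (y - x)))"
  have "convex_on UNIV g"
  proof (rule convex_onI)
    fix t a b :: real
    assume "0 < t" "t < 1"
    have "x + ((1 - t) *\<^sub>R a + t *\<^sub>R b) *\<^sub>R (y - x)
        = (1 - t) *\<^sub>R (x + a *\<^sub>R (y - x)) + t *\<^sub>R (x + b *\<^sub>R (y - x))"
      by (simp add: algebra_simps)
    then show "g ((1 - t) *\<^sub>R a + t *\<^sub>R b) \<le> (1 - t) * g a + t * g b"
      unfolding g_def using convex_onD[OF assms(1), of t] \<open>0 < t\<close> \<open>t < 1\<close> by simp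
  qed simp
  moreover have "(g has_real_derivative f' (y - x)) (at 0 within UNIV)"
  proof -
    interpret f': bounded_linear f' by (rule has_derivative_bounded_linear[OF assms(2)])
    have "(f has_derivative f') (at (x + 0 *\<^sub>R (y - x)))"
      using assms(2) by simp
    then have "(g has_derivative (\<lambda>s. f' (s *\<^sub>R (y - x)))) (at 0)"
      unfolding g_def
      by (rule has_derivative_compose[rotated]) (auto intro!: derivative_eq_intros)
    then show ?thesis
      by (simp add: has_field_derivative_def f'.scaleR mult.commute[of _ "f' (y - x)"])
  qed
  ultimately have "g 1 - g 0 \<ge> f' (y - x) * (1 - 0)"
    by (intro convex_on_imp_above_tangent[of UNIV]) auto
  then show ?thesis by (simp add: g_def)
qed

text \<open>Since \<open>gradient\<close> is a definite description, existence and uniqueness are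
  both required. The representing vector has as coordinates the values of the derivative on
  \<open>Basis\<close>.\<close>

lemma GDERIV_gradient:
  fixes f :: "'a::euclidean_space \<Rightarrow> real"
  assumes "f differentiable (at x)"
  shows "GDERIV f x :> gradient f x"
proof -
  obtain f' where f': "(f has_derivative f') (at x)"
    using assms by (auto simp: differentiable_def)
  then interpret bounded_linear f' by (rule has_derivative_bounded_linear)
  have "f' = (\<lambda>h. h \<bullet> (\<Sum>b\<in>Basis. f' b *\<^sub>R b))"
  proof
    fix h
    have "f' h = f' (\<Sum>b\<in>Basis. (h \<bullet> b) *\<^sub>R b)" by (simp add: euclidean_representation)
    also have "\<dots> = h \<bullet> (\<Sum>b\<in>Basis. f' b *\<^sub>R b)"
      by (simp add: sum scaleR inner_sum_right mult.commute)
    finally show "f' h = h \<bullet> (\<Sum>b\<in>Basis. f' b *\<^sub>R b)" .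
  qed
  with f' have "GDERIV f x :> (\<Sum>b\<in>Basis. f' b *\<^sub>R b)" by (simp add: gderiv_def)
  moreover have "D = D'" if "GDERIV f x :> D" "GDERIV f x :> D'" for D D'
  proof -
    have "(\<lambda>h. h \<bullet> D) = (\<lambda>h. h \<bullet> D')"
      using that unfolding gderiv_def by (rule has_derivative_unique)
    then show ?thesis by (simp add: fun_eq_iff vector_eq_ldot)
  qed
  ultimately have "\<exists>!D. GDERIV f x :> D" by blast
  then show ?thesis unfolding gradient_def by (rule theI')
qed

lemma positive_definite_gain_matrix_iff:
  "positive_definite (gain_matrix a b) \<longleftrightarrow> 0 < a \<and> 0 < b"
proof
  assume "positive_definite (gain_matrix a b)"
  then have pos: "0 < x \<bullet> (gain_matrix a b *v x)" if "x \<noteq> 0" for x :: "real^2"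
    using that by (simp add: positive_definite_def)
  have "axis 1 1 \<noteq> (0::real^2)" "axis 2 1 \<noteq> (0::real^2)" by (simp_all add: axis_eq_0_iff)
  from this[THEN pos] show "0 < a \<and> 0 < b"
    by (simp add: gain_matrix_def matrix_vector_mult_def inner_vec_def sum_2 axis_def)
next
  assume "0 < a \<and> 0 < b"
  moreover have "0 < a * (x $ 1)\<^sup>2 + b * (x $ 2)\<^sup>2" if "x \<noteq> 0" "0 < a" "0 < b" for x :: "real^2"
    using that by (auto simp: vec_eq_iff forall_2 intro: add_pos_nonneg add_nonneg_pos)
  ultimately show "positive_definite (gain_matrix a b)"
    by (auto simp: positive_definite_def gain_matrix_def matrix_vector_mult_def inner_vec_def
        sum_2 transpose_def vec_eq_iff forall_2 power2_eq_square algebra_simps)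
qed

lemma gain_matrix_mult_vec [simp]:
  "(gain_matrix a b *v x) $ 1 = a * x $ 1" "(gain_matrix a b *v x) $ 2 = b * x $ 2"
  by (simp_all add: gain_matrix_def matrix_vector_mult_def sum_2)

text \<open>This turns the rank-one matrix product in \<open>adaptive_law\<close> into a scalar
  multiple of the gradient.\<close>

lemma columnvector_rowvector_mult_vec:
  fixes g x :: "real^'n"
  shows "(columnvector g :: real^1^'n) *v ((rowvector g :: real^'n^1) *v x) = (g \<bullet> x) *\<^sub>R g"
  by (simp add: vec_eq_iff columnvector_def rowvector_def
      matrix_vector_mult_def inner_vec_def sum_distrib_left algebra_simps)

lemma adaptive_law_dissipation:
  assumes "0 < \<rho>1" "0 < \<rho>2"
    and "convex_on UNIV \<alpha>" and "\<alpha> differentiable (at z)" and "\<alpha> \<zeta> \<le> 0"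
  shows "(\<zeta> - z) \<bullet> regressor v
    \<le> (\<zeta> - z) $ 1 * adaptive_law \<alpha> (gain_matrix \<rho>1 \<rho>2) v z $ 1 / \<rho>1
      + (\<zeta> - z) $ 2 * adaptive_law \<alpha> (gain_matrix \<rho>1 \<rho>2) v z $ 2 / \<rho>2"
proof -
  let ?P = "gain_matrix \<rho>1 \<rho>2" and ?g = "gradient \<alpha> z" and ?e = "regressor v"
  \<comment> \<open>The weights \<open>1 / \<rho>1\<close> and \<open>1 / \<rho>2\<close> act as the
    inverse of \<open>?P\<close>, so the gains drop out.\<close>
  have weighted: "w $ 1 * (?P *v x) $ 1 / \<rho>1 + w $ 2 * (?P *v x) $ 2 / \<rho>2 = w \<bullet> x" for w x
    using assms(1,2) by (simp add: inner_vec_def sum_2)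
  show ?thesis
  proof (cases "\<alpha> z < 0 \<or> ?g \<bullet> (?P *v ?e) \<le> 0")
    case True
    then have "adaptive_law \<alpha> ?P v z = ?P *v ?e" by (simp add: adaptive_law_def)
    then show ?thesis using weighted[of "\<zeta> - z" ?e] by (simp only: order_refl)
  next
    case False
    \<comment> \<open>With this coefficient the projected velocity
      \<open>?P *v (?e - c *\<^sub>R ?g)\<close> is orthogonal to \<open>?g\<close>.\<close>
    define c where "c = ?g \<bullet> (?P *v ?e) / (?g \<bullet> (?P *v ?g))"
    have "adaptive_law \<alpha> ?P v z = ?P *v (?e - c *\<^sub>R ?g)"
      using False unfolding adaptive_law_def Let_def c_def
      by (simp add: matrix_vector_mul_assoc[symmetric] columnvector_rowvector_mult_vec
          matrix_vector_mult_diff_distrib matrix_vector_mult_scaleR)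
    then have "(\<zeta> - z) $ 1 * adaptive_law \<alpha> ?P v z $ 1 / \<rho>1
        + (\<zeta> - z) $ 2 * adaptive_law \<alpha> ?P v z $ 2 / \<rho>2 = (\<zeta> - z) \<bullet> (?e - c *\<^sub>R ?g)"
      by (simp only: weighted)
    moreover have "0 \<le> c"
      unfolding c_def using False assms(1,2)
      by (intro divide_nonneg_nonneg) (auto simp: inner_vec_def sum_2 algebra_simps)
    \<comment> \<open>The tangent plane at \<open>z\<close> bounds the inner product by
      \<open>\<alpha> \<zeta> - \<alpha> z\<close>, and \<open>\<alpha> z\<close> is nonnegative in
      this case.\<close>
    moreover have "(\<zeta> - z) \<bullet> ?g \<le> 0"
      using convex_on_above_tangent_plane[OF assms(3) GDERIV_gradient[OF assms(4), unfolded gderiv_def], of \<zeta>]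
        False assms(5) by simp
    ultimately show ?thesis
      by (simp add: inner_diff_right mult_nonneg_nonpos)
  qed
qed

text \<open>In each coordinate the bound by \<open>\<kappa>\<close> is used at
  \<open>c / \<epsilon> * v $ i\<close> and scaled by \<open>\<epsilon>\<close>. The sum over
  coordinates is then compared with the Euclidean norm through the l1 norm.\<close>

lemma robust_term_bound:
  fixes v :: "real^'n"
  assumes "0 < \<epsilon>" and "\<And>x. \<bar>x\<bar> - x * F x \<le> \<kappa>"
  shows "c * norm v - real CARD('n) * \<kappa> * \<epsilon> \<le> c * (v \<bullet> elementwise F ((c / \<epsilon>) *\<^sub>R v))"
proof -
  have coordinate: "\<bar>c\<bar> * \<bar>v $ i\<bar> - \<kappa> * \<epsilon> \<le> c * (v $ i * F (c / \<epsilon> * v $ i))" for i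
  proof -
    let ?x = "c / \<epsilon> * v $ i"
    have "\<epsilon> * (\<bar>?x\<bar> - ?x * F ?x) \<le> \<epsilon> * \<kappa>"
      using assms by (intro mult_left_mono assms(2) less_imp_le)
    moreover have "\<epsilon> * (\<bar>?x\<bar> - ?x * F ?x) = \<bar>c\<bar> * \<bar>v $ i\<bar> - c * (v $ i * F ?x)"
      using assms(1) by (simp add: abs_mult right_diff_distrib)
    ultimately show ?thesis by (simp add: mult.commute)
  qed
  \<comment> \<open>The estimate \<open>c\<close> may be negative, hence the passage to its absolute
    value.\<close>
  have "c * norm v \<le> \<bar>c\<bar> * norm v" by (intro mult_right_mono) auto
  also have "\<dots> \<le> \<bar>c\<bar> * (\<Sum>i\<in>UNIV. \<bar>v $ i\<bar>)"
    by (intro mult_left_mono norm_le_l1_cart) auto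
  finally have "c * norm v - real CARD('n) * \<kappa> * \<epsilon> \<le> (\<Sum>i\<in>UNIV. \<bar>c\<bar> * \<bar>v $ i\<bar> - \<kappa> * \<epsilon>)"
    by (simp add: sum_subtractf sum_distrib_left)
  also have "\<dots> \<le> (\<Sum>i\<in>UNIV. c * (v $ i * F (c / \<epsilon> * v $ i)))"
    by (intro sum_mono coordinate)
  finally show ?thesis by (simp add: elementwise_def inner_vec_def sum_distrib_left)
qed

text \<open>The adaptation terms enter with a minus sign because \<open>\<zeta>\<close> is constant,
  so that \<open>\<zeta> - z t\<close> has derivative \<open>- z'\<close>.\<close>

lemma V_epv_has_real_derivative:
  assumes "\<rho>1 \<noteq> 0" "\<rho>2 \<noteq> 0"
    and "(p has_vector_derivative p') (at t within S)"
    and "(v has_vector_derivative v') (at t within S)"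
    and "(z has_vector_derivative z') (at t within S)"
  shows "((\<lambda>t. V_epv k \<rho>1 \<rho>2 \<zeta> (p t) (v t) (z t)) has_real_derivative
    k * (p t \<bullet> p') + v t \<bullet> v'
      - ((\<zeta> - z t) $ 1 * z' $ 1 / \<rho>1 + (\<zeta> - z t) $ 2 * z' $ 2 / \<rho>2)) (at t within S)"
proof -
  have "((\<lambda>t. z t $ i) has_vector_derivative z' $ i) (at t within S)" for i
    by (rule bounded_linear.has_vector_derivative[OF bounded_linear_vec_nth assms(5)])
  then have component: "((\<lambda>t. z t $ i) has_real_derivative z' $ i) (at t within S)" for i
    by (simp add: has_real_derivative_iff_has_vector_derivative)
  have square: "((\<lambda>t. u t \<bullet> u t) has_real_derivative 2 * (u t \<bullet> u')) (at t within S)"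
    if "(u has_vector_derivative u') (at t within S)" for u u'
    using has_derivative_inner[OF that[unfolded has_vector_derivative_def]
        that[unfolded has_vector_derivative_def]]
    by (simp add: has_field_derivative_def inner_commute mult_commute_abs algebra_simps)
  have quotient: "((\<lambda>t. (\<zeta> $ i - z t $ i)\<^sup>2 / (2 * \<rho>)) has_real_derivative
      - ((\<zeta> $ i - z t $ i) * z' $ i / \<rho>)) (at t within S)" if "\<rho> \<noteq> 0" for i and \<rho> :: real
    using that
    by (auto intro!: derivative_eq_intros component simp: field_simps power2_eq_square)
  show ?thesis
    unfolding V_epv_def V_ep_def vector_minus_component
    by (rule derivative_eq_intros square quotient assms refl)+ (simp add: mult.commute)
qed

text \<open>At least one norm exceeds its radius; its squared term alone is then larger than the
  left side, and the other term is nonnegative.\<close>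

lemma outside_attractive_set:
  fixes p v :: "real^'n"
  assumes "0 \<le> \<kappa>" "kFe > 0" "kep > 0" "kev > 0" "\<epsilon> > 0"
    and "(p, v) \<notin> attractive_set kFe kep kev \<epsilon> \<kappa>"
  shows "real CARD('n) * \<kappa> * \<epsilon> < kep * kFe * (norm p)\<^sup>2 + kev * (norm v)\<^sup>2"
proof -
  define m where "m = real CARD('n) * \<kappa> * \<epsilon>"
  have radius: "m < k * r\<^sup>2" if "0 < k" "0 \<le> r" "sqrt (m / k) < r" for k r
  proof -
    have "m / k < r\<^sup>2"
      using that real_sqrt_less_iff[of "m / k" "r\<^sup>2"] by simp
    then show ?thesis using that(1) by (simp add: field_simps)
  qed
  have "sqrt (m / (kep * kFe)) < norm p \<or> sqrt (m / kev) < norm v"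
    using assms(6) by (auto simp: attractive_set_def m_def)
  then have "m < kep * kFe * (norm p)\<^sup>2 \<or> m < kev * (norm v)\<^sup>2"
    using radius assms(2-4) by auto
  moreover have "0 \<le> kep * kFe * (norm p)\<^sup>2" "0 \<le> kev * (norm v)\<^sup>2"
    using assms(2-4) by simp_all
  ultimately show ?thesis unfolding m_def[symmetric] by linarith
qed

theorem lemma3:
  fixes F :: "real \<Rightarrow> real" and \<kappa> :: real
    and kFe kep kev \<epsilon>p \<rho>1 \<rho>2 :: real
    and \<alpha> :: "real^2 \<Rightarrow> real" and \<zeta> :: "real^2" and P :: "real^2^2"
    and T N :: "real set"
    and ep ev Fe ae ad :: "real \<Rightarrow> real^'n" and zh :: "real \<Rightarrow> real^2"
  assumes F_zero: "F 0 = 0"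
    and F_top: "(F \<longlongrightarrow> 1) at_top"
    and F_bot: "(F \<longlongrightarrow> -1) at_bot"
    and kappa_attained: "\<kappa> \<in> range (\<lambda>x. \<bar>x\<bar> - x * F x)"
    and kappa_upper: "\<And>x. \<bar>x\<bar> - x * F x \<le> \<kappa>"
    and gains: "kFe > 0" "kep > 0" "kev > 0" "\<epsilon>p > 0"
    and P_def: "P = gain_matrix \<rho>1 \<rho>2"
    and P_pos: "positive_definite P"
    and alpha_smooth: "smooth_function \<alpha>"
    and alpha_convex: "convex_on UNIV \<alpha>"
    and zeta_admissible: "\<zeta> \<in> admissible_set \<alpha>"
    (* The closed loop holds on the time interval T up to a null set N of exceptional times:
       the adaptive law is discontinuous, so solutions are in general only a.e. differentiable.
       Classical solutions are the case N = {}. *)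
    and time_interval: "is_interval T" "interior T \<noteq> {}"
    and null_set: "negligible N"
    and Fe_eq: "\<And>t. t \<in> T \<Longrightarrow> Fe t = - (kFe *\<^sub>R ep t)"
    and ae_eq: "\<And>t. t \<in> T \<Longrightarrow> ae t = control_law F kep kev \<epsilon>p (ep t) (ev t) (zh t)"
    and ep_ode: "\<And>t. t \<in> T - N \<Longrightarrow>
        (ep has_vector_derivative (Fe t + ev t)) (at t within T)"
    and ev_ode: "\<And>t. t \<in> T - N \<Longrightarrow>
        (ev has_vector_derivative (ae t + ad t - vector_derivative Fe (at t within T)))
          (at t within T)"
    and zh_ode: "\<And>t. t \<in> T - N \<Longrightarrow>
        (zh has_vector_derivative adaptive_law \<alpha> P (ev t) (zh t)) (at t within T)"
    and disturbance_bound: "\<And>t. t \<in> T - N \<Longrightarrow>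
        norm (ad t - vector_derivative Fe (at t within T)) \<le> \<zeta> $ 1 + \<zeta> $ 2 * norm (ev t)"
  shows "\<forall>t \<in> T - N. (ep t, ev t) \<notin> attractive_set kFe kep kev \<epsilon>p \<kappa> \<longrightarrow>
    (\<exists>D < 0. ((\<lambda>t. V_epv kep \<rho>1 \<rho>2 \<zeta> (ep t) (ev t) (zh t)) has_real_derivative D)
       (at t within T))"
proof (intro ballI impI)
  fix t
  assume t: "t \<in> T - N" and out: "(ep t, ev t) \<notin> attractive_set kFe kep kev \<epsilon>p \<kappa>"
  \<comment> \<open>This is the lumped disturbance, the only part of the velocity equation outside
    the control law.\<close>
  define d where "d = ad t - vector_derivative Fe (at t within T)"
  define p v z where "p = ep t" and "v = ev t" and "z = zh t"
  define z' where "z' = adaptive_law \<alpha> P v z"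
  let ?D = "kep * (p \<bullet> (Fe t + v)) + v \<bullet> (ae t + d)
    - ((\<zeta> - z) $ 1 * z' $ 1 / \<rho>1 + (\<zeta> - z) $ 2 * z' $ 2 / \<rho>2)"
  have \<rho>: "0 < \<rho>1" "0 < \<rho>2"
    using P_pos P_def by (simp_all add: positive_definite_gain_matrix_iff)
  have "C_k_function (Suc 0) \<alpha>"
    using alpha_smooth unfolding smooth_function_def by blast
  then have "\<alpha> differentiable (at z)"
    by (simp add: differentiable_on_def)
  then have adaptation: "(\<zeta> - z) \<bullet> regressor v
      \<le> (\<zeta> - z) $ 1 * z' $ 1 / \<rho>1 + (\<zeta> - z) $ 2 * z' $ 2 / \<rho>2"
    unfolding z'_def P_def using zeta_admissible
    by (intro adaptive_law_dissipation \<rho> alpha_convex) (simp_all add: admissible_set_def)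
  have disturbance: "v \<bullet> d \<le> norm v * (\<zeta> $ 1 + \<zeta> $ 2 * norm v)"
    using norm_cauchy_schwarz[of v d] disturbance_bound[OF t]
    unfolding d_def[symmetric] v_def[symmetric] by (meson mult_left_mono norm_ge_zero order_trans)
  have "0 \<le> \<kappa>" using kappa_upper[of 0] by simp
  have "((\<lambda>t. V_epv kep \<rho>1 \<rho>2 \<zeta> (ep t) (ev t) (zh t)) has_real_derivative ?D) (at t within T)"
    using V_epv_has_real_derivative[OF _ _ ep_ode[OF t] ev_ode[OF t] zh_ode[OF t]] \<rho>
    unfolding p_def v_def z_def z'_def d_def by (simp add: add_diff_eq)
  moreover have "?D < 0"
  proof -
    \<comment> \<open>The term \<open>kep * (p \<bullet> v)\<close> from the position error cancels
      against the one produced by \<open>- (kep *\<^sub>R ep)\<close> in the control law.\<close>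
    have "kep * (p \<bullet> (Fe t + v)) + v \<bullet> (ae t + d)
      = v \<bullet> d - kep * kFe * (norm p)\<^sup>2 - kev * (norm v)\<^sup>2
        - z $ 1 * (v \<bullet> elementwise F ((z $ 1 / \<epsilon>p) *\<^sub>R v)) - z $ 2 * (norm v)\<^sup>2"
      using t unfolding p_def v_def z_def
      by (simp add: Fe_eq ae_eq control_law_def power2_norm_eq_inner inner_commute
          inner_add_right inner_diff_right algebra_simps)
    \<comment> \<open>This is exactly what remains of the disturbance bound once
      \<open>z $ 1 * norm v\<close> and \<open>z $ 2 * (norm v)\<^sup>2\<close> are subtracted, so
      \<open>adaptation\<close> absorbs it.\<close>
    moreover have "(\<zeta> - z) \<bullet> regressor v
        = (\<zeta> $ 1 - z $ 1) * norm v + (\<zeta> $ 2 - z $ 2) * (norm v)\<^sup>2"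
      by (simp add: regressor_def inner_vec_def sum_2)
    moreover note adaptation disturbance
      robust_term_bound[OF gains(4) kappa_upper, where c = "z $ 1" and v = v]
      outside_attractive_set[OF \<open>0 \<le> \<kappa>\<close> gains out, folded p_def v_def]
    ultimately show ?thesis by (simp add: algebra_simps power2_eq_square)
  qed
  ultimately show "\<exists>D<0. ((\<lambda>t. V_epv kep \<rho>1 \<rho>2 \<zeta> (ep t) (ev t) (zh t))
      has_real_derivative D) (at t within T)"
    by blast
qed

end
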